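(* Let $q \in \mathbb{Q}_{>0} \setminus \mathbb{N}$, and let $M_q$ be the underlying additive monoid of the semiring $\mathbb{N}_0[q]$. Then each $r \in \mathbb{N}_0[q]$ can be uniquely written as $$r = c_0(r) + \sum_{n \in \mathbb{N}} c_n(r) q^n,$$ where $(c_n(r))_{n \ge 0}$ is a sequence of nonnegative integers, all but finitely many of whose terms are zero, with $c_n(r) \in \{0, 1, \dots, \mathsf{d}(q)-1\}$ for every $n \in \mathbb{N}$.
   Context: For $q \in \mathbb{Q}_{>0}$, $\mathbb{N}_0[q] = \{f(q) : f(x) \in \mathbb{N}_0[x]\}$, whose underlying additive monoid is $M_q = \langle q^n : n \in \mathbb{N}_0\rangle$. For a positive rational $q$, $\mathsf{d}(q)$ denotes its denominator in lowest terms. Here $\mathbb{N} = \{1,2,3,\dots\}$ and $\mathbb{N}_0 = \mathbb{N} \cup \{0\}$. *)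

theory Defs
  imports "HOL-Computational_Algebra.Polynomial"
begin

definition nat_adjoin :: "rat \<Rightarrow> rat set" where
  "nat_adjoin q = {poly (map_poly of_nat f) q | f :: nat poly. True}"

text \<open>\<^const>\<open>quotient_of\<close> returns the pair in lowest terms with positive second
  component, so the conversion to \<^typ>\<open>nat\<close> loses nothing.\<close>
definition rat_denom :: "rat \<Rightarrow> nat" where
  "rat_denom q = nat (snd (quotient_of q))"

end

theory Submission
  imports Defs
begin

text \<open>Write $q = a/b$ in lowest terms. The relation $b\,q^{n+1} = a\,q^n$ lets one
  carry multiples of $b$ downwards: starting at the leading coefficient and descending to degree 1,
  every coefficient is replaced by its remainder modulo $b$. Conversely, if an integer combination
  of $1, q, \dots, q^n$ vanishes, clearing denominators shows that $b$ divides the leading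
  coefficient; a coefficient smaller than $b$ in absolute value is therefore zero.\<close>

lemma rat_fraction_nat:
  fixes q :: rat
  assumes "q > 0"
  obtains a where "q = of_nat a / of_nat (rat_denom q)" "coprime a (rat_denom q)" "rat_denom q > 0"
proof -
  obtain u v where uv: "quotient_of q = (u, v)"
    by force
  have v: "v > 0" and q: "q = of_int u / of_int v" and cop: "coprime u v"
    using quotient_of_denom_pos[OF uv] quotient_of_div[OF uv] quotient_of_coprime[OF uv] by auto
  from assms q v have u: "u > 0"
    by (simp add: zero_less_divide_iff)
  have b: "rat_denom q = nat v"
    by (simp add: rat_denom_def uv)
  show thesis
  proof
    show "q = of_nat (nat u) / of_nat (rat_denom q)"
      using u v q b by simp
    show "coprime (nat u) (rat_denom q)"
      using cop u v b by (simp flip: coprime_int_iff)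
    show "rat_denom q > 0"
      using v b by simp
  qed
qed

text \<open>Induction on the degree: each carry changes the coefficient one place below, so
  \<open>f\<close> must be arbitrary. Digit 0 has no bound, because nothing lies beneath it to carry
  into. Zeros above \<open>n\<close> make \<open>c\<close> finitely supported.\<close>

lemma power_sum_reduce:
  fixes q :: rat
  assumes q: "q = of_nat a / of_nat b" and b: "b > 0"
  shows "\<exists>c. (\<forall>i>n. c i = 0) \<and> (\<forall>i\<ge>1. c i < b) \<and>
           (\<Sum>i\<le>n. of_nat (f i) * q ^ i) = (\<Sum>i\<le>n. of_nat (c i) * q ^ i)"
proof (induction n arbitrary: f)
  case 0
  show ?case
    using b by (intro exI[of _ "\<lambda>i. if i = 0 then f 0 else 0"]) auto
next
  case (Suc n)
  define k where "k = f (Suc n) div b"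
  define r where "r = f (Suc n) mod b"
  have f: "f (Suc n) = b * k + r"
    by (simp add: k_def r_def)
  have carry: "of_nat b * q = of_nat a"
    using b by (simp add: q)
  \<comment> \<open>The induction hypothesis is applied after the carry: \<open>b * k\<close> copies
    of \<open>q ^ Suc n\<close> become \<open>a * k\<close> copies of \<open>q ^ n\<close>, while
    the remainder \<open>r\<close> is kept as the digit at \<open>Suc n\<close>.\<close>
  obtain c where c: "\<forall>i>n. c i = 0" "\<forall>i\<ge>1. c i < b"
    and sum_c: "(\<Sum>i\<le>n. of_nat ((f(n := f n + a * k)) i) * q ^ i)
      = (\<Sum>i\<le>n. of_nat (c i) * q ^ i)"
    using Suc.IH by metis
  have "(\<Sum>i\<le>n. of_nat ((f(n := f n + a * k)) i) * q ^ i)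
      = (\<Sum>i\<le>n. of_nat (f i) * q ^ i + (if i = n then of_nat (a * k) * q ^ n else 0))"
    by (intro sum.cong) (auto simp: algebra_simps)
  also have "\<dots> = (\<Sum>i\<le>n. of_nat (f i) * q ^ i) + of_nat (a * k) * q ^ n"
    by (simp add: sum.distrib)
  finally have low: "(\<Sum>i\<le>n. of_nat (c i) * q ^ i)
      = (\<Sum>i\<le>n. of_nat (f i) * q ^ i) + of_nat (a * k) * q ^ n"
    using sum_c by simp
  have "of_nat (f (Suc n)) * q ^ Suc n
      = of_nat b * q * of_nat k * q ^ n + of_nat r * q ^ Suc n"
    by (simp add: f algebra_simps)
  also have "\<dots> = of_nat (a * k) * q ^ n + of_nat r * q ^ Suc n"
    by (simp add: carry)
  finally have "(\<Sum>i\<le>Suc n. of_nat (f i) * q ^ i)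
      = (\<Sum>i\<le>n. of_nat (c i) * q ^ i) + of_nat r * q ^ Suc n"
    using low by simp
  also have "\<dots> = (\<Sum>i\<le>Suc n. of_nat ((c(Suc n := r)) i) * q ^ i)"
    by (simp)
  finally show ?case
    using c b by (intro exI[of _ "c(Suc n := r)"]) (auto simp: r_def)
qed

text \<open>Integer coefficients are allowed so that the lemma applies to the difference of two
  digit sequences. Once the top coefficient is known to vanish, the sum shortens and induction
  finishes; at degree 0 the sum is \<open>e 0\<close> itself, which therefore needs no
  bound.\<close>

lemma power_sum_eq_0:
  fixes q :: rat and e :: "nat \<Rightarrow> int"
  assumes q: "q = of_nat a / of_nat b" and b: "b > 0" and cop: "coprime a b"
    and e: "\<And>i. i \<ge> 1 \<Longrightarrow> \<bar>e i\<bar> < int b"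
    and "(\<Sum>i\<le>n. of_int (e i) * q ^ i) = 0" and "i \<le> n"
  shows "e i = 0"
  using assms(5,6)
proof (induction n)
  case 0
  then show ?case by simp
next
  case (Suc n)
  \<comment> \<open>\<open>z\<close> is the sum up to degree \<open>n\<close> cleared of
    denominators by \<open>b ^ n\<close>. Clearing degree \<open>Suc n\<close> takes one more factor
    \<open>b\<close>, so all terms below the top become divisible by \<open>b\<close>.\<close>
  define z where "z = (\<Sum>i\<le>n. e i * int a ^ i * int b ^ (n - i))"
  have "of_nat b ^ n * (\<Sum>i\<le>n. of_int (e i) * q ^ i) = of_int z"
    unfolding z_def sum_distrib_left of_int_sum
  proof (rule sum.cong)
    fix i assume "i \<in> {..n}"
    then have "(of_nat b :: rat) ^ n = of_nat b ^ i * of_nat b ^ (n - i)"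
      by (simp flip: power_add)
    then show "of_nat b ^ n * (of_int (e i) * q ^ i)
        = of_int (e i * int a ^ i * int b ^ (n - i))"
      using b by (simp add: q power_divide)
  qed simp
  moreover have "of_nat b ^ Suc n * (of_int (e (Suc n)) * q ^ Suc n)
      = of_int (e (Suc n) * int a ^ Suc n)"
    using b by (simp add: q power_divide)
  ultimately have "of_nat b ^ Suc n * (\<Sum>i\<le>Suc n. of_int (e i) * q ^ i)
      = of_int (int b * z + e (Suc n) * int a ^ Suc n)"
    by (simp add: ring_distribs mult.assoc)
  then have "of_int (int b * z + e (Suc n) * int a ^ Suc n) = (0 :: rat)"
    using Suc.prems(1) by simp
  then have "int b * z + e (Suc n) * int a ^ Suc n = 0"
    by (simp only: of_int_eq_0_iff)
  then have "e (Suc n) * int a ^ Suc n = int b * (- z)"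
    by simp
  then have "int b dvd e (Suc n) * int a ^ Suc n"
    by (rule dvdI)
  moreover have "coprime (int b) (int a ^ Suc n)"
    using cop by (simp add: coprime_commute)
  ultimately have "int b dvd e (Suc n)"
    by (simp add: coprime_dvd_mult_left_iff)
  \<comment> \<open>A nonzero multiple of \<open>b\<close> has absolute value at least
    \<open>b\<close>, against the bound on \<open>e\<close>.\<close>
  then have top: "e (Suc n) = 0"
    using e[of "Suc n"] dvd_imp_le_int[of "e (Suc n)" "int b"] by linarith
  show ?case
  proof (cases "i = Suc n")
    case False
    then show ?thesis
      using Suc top by simp
  qed (use top in simp)
qed

text \<open>Passes from sums over initial segments, which suit induction, to the sum over the
  support. Any bound \<open>N\<close> on the support will do, so two expansions can be compared over
  a common range.\<close>

lemma sum_atMost_eq_sum_support: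
  fixes q :: rat and c :: "nat \<Rightarrow> nat"
  assumes "\<And>n. n > N \<Longrightarrow> c n = 0"
  shows "(\<Sum>i\<le>N. of_nat (c i) * q ^ i)
       = of_nat (c 0) + (\<Sum>n | n \<ge> 1 \<and> c n \<noteq> 0. of_nat (c n) * q ^ n)"
proof -
  have "(\<Sum>i\<le>N. of_nat (c i) * q ^ i) = of_nat (c 0) + (\<Sum>i=1..N. of_nat (c i) * q ^ i)"
    by (simp add: atMost_atLeast0 sum.atLeast_Suc_atMost)
  also have "(\<Sum>i=1..N. of_nat (c i) * q ^ i) = (\<Sum>n | n \<ge> 1 \<and> c n \<noteq> 0. of_nat (c n) * q ^ n)"
  proof (rule sum.mono_neutral_right)
    show "{n. n \<ge> 1 \<and> c n \<noteq> 0} \<subseteq> {1..N}"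
    proof
      fix n assume "n \<in> {n. n \<ge> 1 \<and> c n \<noteq> 0}"
      then show "n \<in> {1..N}"
        using assms[of n] by (cases "n \<le> N") auto
    qed
  qed auto
  finally show ?thesis .
qed

theorem proposition6p1:
  fixes q :: rat
  assumes "q > 0" and "q \<notin> \<nat>"
  shows "\<forall>r \<in> nat_adjoin q. \<exists>!c :: nat \<Rightarrow> nat.
           finite {n. c n \<noteq> 0} \<and>
           (\<forall>n\<ge>1. c n \<in> {0..rat_denom q - 1}) \<and>
           r = of_nat (c 0) + (\<Sum>n | n \<ge> 1 \<and> c n \<noteq> 0. of_nat (c n) * q ^ n)"
proof
  fix r assume "r \<in> nat_adjoin q"
  then obtain f where r: "r = poly (map_poly of_nat f) q"
    by (auto simp: nat_adjoin_def)
  define b where "b = rat_denom q"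
  obtain a where q: "q = of_nat a / of_nat b" and cop: "coprime a b" and b: "b > 0"
    unfolding b_def by (rule rat_fraction_nat[OF assms(1)])
  have r_sum: "r = (\<Sum>i\<le>degree f. of_nat (coeff f i) * q ^ i)"
    by (simp add: r poly_altdef degree_map_poly coeff_map_poly)
  obtain c where c: "\<forall>i>degree f. c i = 0" "\<forall>i\<ge>1. c i < b"
    and c_sum: "r = (\<Sum>i\<le>degree f. of_nat (c i) * q ^ i)"
    using power_sum_reduce[OF q b, of "degree f" "coeff f"] unfolding r_sum by blast
  have "\<exists>!c. finite {n. c n \<noteq> 0} \<and> (\<forall>n\<ge>1. c n \<in> {0..b - 1}) \<and>
           r = of_nat (c 0) + (\<Sum>n | n \<ge> 1 \<and> c n \<noteq> 0. of_nat (c n) * q ^ n)" (is "\<exists>!c. ?P c")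
  proof (rule ex_ex1I)
    have "finite {n. c n \<noteq> 0}"
      using c(1) unfolding finite_nat_set_iff_bounded_le by (metis mem_Collect_eq not_le)
    moreover have "\<forall>n\<ge>1. c n \<in> {0..b - 1}"
      using c(2) b by fastforce
    moreover have "r = of_nat (c 0) + (\<Sum>n | n \<ge> 1 \<and> c n \<noteq> 0. of_nat (c n) * q ^ n)"
      unfolding c_sum by (rule sum_atMost_eq_sum_support) (use c(1) in blast)
    ultimately show "\<exists>c. ?P c"
      by blast
  next
    fix c d assume "?P c" and "?P d"
    then have r_c: "r = of_nat (c 0) + (\<Sum>n | n \<ge> 1 \<and> c n \<noteq> 0. of_nat (c n) * q ^ n)"
      and r_d: "r = of_nat (d 0) + (\<Sum>n | n \<ge> 1 \<and> d n \<noteq> 0. of_nat (d n) * q ^ n)"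
      and fin: "finite {n. c n \<noteq> 0}" "finite {n. d n \<noteq> 0}"
      and digits: "\<forall>n\<ge>1. c n \<in> {0..b - 1}" "\<forall>n\<ge>1. d n \<in> {0..b - 1}"
      by blast+
    from fin have "finite ({n. c n \<noteq> 0} \<union> {n. d n \<noteq> 0})"
      by simp
    \<comment> \<open>One bound for both supports lets the two expansions be subtracted term by
      term.\<close>
    then obtain N where N: "\<And>n. c n \<noteq> 0 \<or> d n \<noteq> 0 \<Longrightarrow> n \<le> N"
      unfolding finite_nat_set_iff_bounded_le by blast
    have c_high: "c n = 0" and d_high: "d n = 0" if "n > N" for n
      using N[of n] that leD by blast+
    have c_sum: "r = (\<Sum>i\<le>N. of_nat (c i) * q ^ i)"
      by (rule trans[OF r_c sum_atMost_eq_sum_support[OF c_high, symmetric]])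
    have d_sum: "r = (\<Sum>i\<le>N. of_nat (d i) * q ^ i)"
      by (rule trans[OF r_d sum_atMost_eq_sum_support[OF d_high, symmetric]])
    have "(\<Sum>i\<le>N. of_int (int (c i) - int (d i)) * q ^ i)
        = (\<Sum>i\<le>N. of_nat (c i) * q ^ i) - (\<Sum>i\<le>N. of_nat (d i) * q ^ i)"
      by (simp add: left_diff_distrib sum_subtractf)
    also have "\<dots> = 0"
      by (simp flip: c_sum d_sum)
    finally have zero: "(\<Sum>i\<le>N. of_int (int (c i) - int (d i)) * q ^ i) = 0" .
    \<comment> \<open>Two numbers between 0 and \<open>b - 1\<close> differ by less than
      \<open>b\<close>; positivity of \<open>b\<close> keeps the subtraction on naturals from
      truncating.\<close>
    have small: "\<bar>int (c i) - int (d i)\<bar> < int b" if "i \<ge> 1" for i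
    proof -
      have "c i \<le> b - 1" "d i \<le> b - 1"
        using digits that by auto
      then show ?thesis
        using b by linarith
    qed
    show "c = d"
    proof
      fix i
      show "c i = d i"
      proof (cases "i \<le> N")
        case True
        then show ?thesis
          using power_sum_eq_0[OF q b cop small zero] by simp
      \<comment> \<open>Beyond \<open>N\<close> both sequences are zero.\<close>
      qed (metis N)
    qed
  qed
  then show "\<exists>!c :: nat \<Rightarrow> nat. finite {n. c n \<noteq> 0} \<and>
           (\<forall>n\<ge>1. c n \<in> {0..rat_denom q - 1}) \<and>
           r = of_nat (c 0) + (\<Sum>n | n \<ge> 1 \<and> c n \<noteq> 0. of_nat (c n) * q ^ n)"
    by (simp only: b_def)
qed

end
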